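(* Let $a,b,c,d\in\mathbb{C}$. If $\Phi(x,y)=(cx+d)y-(ax+b)$ is a standard polynomial, then all components of $G(\Phi)^*$ are isomorphic to each other.
   Context: Digraphs may be infinite and may have loops and multiple arcs. The (weakly connected) component of a vertex $u$ is the subdigraph induced by all vertices joined to $u$ by a path when arc directions are ignored. For $\Phi(x,y)\in\mathbb{C}[x,y]$, the digraph $G(\Phi)$ has vertex set $\mathbb{C}$, and $(u,v)$ is an arc of multiplicity $m\ge1$ if $v$ is a root of multiplicity $m$ of $\Phi(u,y)$ (if $\Phi(u,y)$ is the zero polynomial, every $(u,v)$ is an arc of multiplicity $1$). Write $\Phi(x,y)=\sum_{i=0}^{p} \alpha_i(x)y^i=\sum_{j=0}^{q} \beta_j(y)x^j$ with $\alpha_p,\beta_q\neq 0$, and set $A(x)=\gcd(\alpha_0,\dots,\alpha_p)$, $B(y)=\gcd(\beta_0,\dots,\beta_q)$, $D(x)=\mathrm{Resultant}(\Phi,\Phi'_y,y)$, $E(y)=\mathrm{Resultant}(\Phi,\Phi'_x,x)$, $L(x)=\Phi(x,x)$, where $\Phi'_x,\Phi'_y$ are the partial derivatives. $\Phi$ is standard if it is non-constant, $A$ and $B$ are constant, and none of $D$, $E$, $L$ is the zero polynomial (non-vanishing of $D$ and $E$ means that $\Phi$ has no repeated non-constant factor). For standard $\Phi$, the singular vertices are the roots of $S(x)=L(x)D(x)E(x)$; equivalently, the vertices $u$ that have a loop, or are the origin or end of a multiple arc, or have $\alpha_p(u)=0$ (outdegree less than $p$) or $\beta_q(u)=0$ (indegree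 less than $q$). A singular component is a component containing a singular vertex. $G(\Phi)^*$ is the digraph obtained from $G(\Phi)$ by removing all singular components. *)

theory Defs
  imports
    Complex_Main
    "HOL-Computational_Algebra.Polynomial_Factorial"
    "HOL-Computational_Algebra.Field_as_Ring"
    "Subresultants.Resultant_Prelim"
    "Graph_Theory.Digraph_Component"
    "Graph_Theory.Digraph_Isomorphism"
begin

text \<open>
  A polynomial \<open>\<Phi>(x,y)\<close> is represented as a polynomial in \<open>y\<close> whose coefficients
  \<open>\<alpha>\<^sub>i = coeff \<Phi> i\<close> are polynomials in \<open>x\<close>. Interchanging the roles of the variables gives
  the polynomial in \<open>x\<close> with coefficients \<open>\<beta>\<^sub>j\<close>, polynomials in \<open>y\<close>.
\<close>

type_synonym bipoly = "complex poly poly"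

definition swap_vars :: "bipoly \<Rightarrow> bipoly" where
  "swap_vars \<Phi> = (\<Sum>i\<le>degree \<Phi>. map_poly (\<lambda>c. monom c i) (coeff \<Phi> i))"

lemma coeff_coeff_swap_vars: "coeff (coeff (swap_vars \<Phi>) j) i = coeff (coeff \<Phi> i) j"
proof -
  have "coeff (coeff (swap_vars \<Phi>) j) i =
      (\<Sum>k\<le>degree \<Phi>. if k = i then coeff (coeff \<Phi> i) j else 0)"
    by (simp add: swap_vars_def coeff_sum coeff_map_poly cong: sum.cong)
  also have "\<dots> = coeff (coeff \<Phi> i) j"
    by (auto simp: coeff_eq_0)
  finally show ?thesis .
qed

definition at_x :: "bipoly \<Rightarrow> complex \<Rightarrow> complex poly" where
  "at_x \<Phi> u = map_poly (\<lambda>\<alpha>. poly \<alpha> u) \<Phi>"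

definition poly_A :: "bipoly \<Rightarrow> complex poly" where
  "poly_A \<Phi> = content \<Phi>"

definition poly_B :: "bipoly \<Rightarrow> complex poly" where
  "poly_B \<Phi> = content (swap_vars \<Phi>)"

text \<open>
  The resultant is the determinant of the Sylvester matrix of size \<open>p + (p - 1)\<close>, so for
  \<open>p = 1\<close> it is \<open>\<alpha>\<^sub>1\<close>. For \<open>p = 0\<close> or \<open>q = 0\<close> the library's value 1 of an
  empty determinant is immaterial: a non-constant polynomial with non-trivial dependence on only
  one of the variables has non-constant content.
\<close>

definition poly_D :: "bipoly \<Rightarrow> complex poly" where
  "poly_D \<Phi> = resultant \<Phi> (pderiv \<Phi>)"

definition poly_E :: "bipoly \<Rightarrow> complex poly" where
  "poly_E \<Phi> = resultant (swap_vars \<Phi>) (pderiv (swap_vars \<Phi>))"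

definition poly_L :: "bipoly \<Rightarrow> complex poly" where
  "poly_L \<Phi> = poly \<Phi> [:0, 1:]"

definition poly_S :: "bipoly \<Rightarrow> complex poly" where
  "poly_S \<Phi> = poly_L \<Phi> * poly_D \<Phi> * poly_E \<Phi>"

definition standard :: "bipoly \<Rightarrow> bool" where
  "standard \<Phi> \<longleftrightarrow>
     \<not> (\<exists>k. \<Phi> = [:[:k:]:]) \<and>
     degree (poly_A \<Phi>) = 0 \<and> degree (poly_B \<Phi>) = 0 \<and>
     poly_D \<Phi> \<noteq> 0 \<and> poly_E \<Phi> \<noteq> 0 \<and> poly_L \<Phi> \<noteq> 0"

definition arc_mult :: "bipoly \<Rightarrow> complex \<Rightarrow> complex \<Rightarrow> nat" where
  "arc_mult \<Phi> u v = (if at_x \<Phi> u = 0 then 1 else order v (at_x \<Phi> u))"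

text \<open>The parallel arcs from \<open>u\<close> to \<open>v\<close> are the triples \<open>(u, v, k)\<close>.\<close>

definition poly_digraph :: "bipoly \<Rightarrow> (complex, complex \<times> complex \<times> nat) pre_digraph" where
  "poly_digraph \<Phi> =
     \<lparr> verts = UNIV,
       arcs = {(u, v, k). k < arc_mult \<Phi> u v},
       tail = (\<lambda>(u, v, k). u),
       head = (\<lambda>(u, v, k). v) \<rparr>"

definition component_of :: "('a, 'b) pre_digraph \<Rightarrow> 'a \<Rightarrow> ('a, 'b) pre_digraph" where
  "component_of G u = G \<restriction> {v. u \<rightarrow>\<^sup>*\<^bsub>with_proj (mk_symmetric G)\<^esub> v}"

definition components :: "('a, 'b) pre_digraph \<Rightarrow> ('a, 'b) pre_digraph set" where
  "components G = component_of G ` verts G"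

definition singular_vertex :: "bipoly \<Rightarrow> complex \<Rightarrow> bool" where
  "singular_vertex \<Phi> u \<longleftrightarrow> poly (poly_S \<Phi>) u = 0"

definition singular_components ::
    "bipoly \<Rightarrow> (complex, complex \<times> complex \<times> nat) pre_digraph set" where
  "singular_components \<Phi> =
     {C \<in> components (poly_digraph \<Phi>). \<exists>u \<in> verts C. singular_vertex \<Phi> u}"

definition poly_digraph_star :: "bipoly \<Rightarrow> (complex, complex \<times> complex \<times> nat) pre_digraph" where
  "poly_digraph_star \<Phi> =
     poly_digraph \<Phi> \<restriction>
       (verts (poly_digraph \<Phi>) - (\<Union>C \<in> singular_components \<Phi>. verts C))"

end

theory Submission
  imports Defs
begin

text \<open>
  If \<open>\<Phi> = (cx + d)y - (ax + b)\<close> is standard, then \<open>ad \<noteq> bc\<close>, so the arcs of \<open>G(\<Phi>)\<close> form the graph of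
  the invertible fractional linear map \<open>f(x) = (ax + b)/(cx + d)\<close>. The singular vertices are the
  fixed points of \<open>f\<close>, its pole and the pole of its inverse. Removing their components leaves a
  vertex set \<open>V\<close> that \<open>f\<close> permutes, and the components of what is left are the two-sided orbits
  \<open>k \<mapsto> f\<^sup>k(u)\<close> of points \<open>u\<close> of \<open>V\<close> (\<open>component_of_bijection_digraph\<close>).

  Such an orbit is a directed cycle or a directed line, and which one it is (and how long the cycle
  is) depends only on the numbers \<open>n\<close> with \<open>f\<^sup>n(u) = u\<close>. These do not depend on \<open>u\<close>, as long as
  \<open>u\<close> is not fixed by \<open>f\<close> (\<open>fractional_linear_return_times_eq\<close>): the matrix \<open>M\<close> with rows \<open>(a, b)\<close>
  and \<open>(c, d)\<close> satisfies \<open>M\<^sup>n = sM + tI\<close> for some scalars \<open>s\<close> and \<open>t\<close> by Cayley-Hamilton, and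
  after clearing denominators the equation \<open>f\<^sup>n(u) = u\<close> becomes \<open>s(cu\<^sup>2 + (d - a)u - b) = 0\<close>. Since
  the second factor vanishes only at fixed points of \<open>f\<close>, the equation says \<open>s = 0\<close>. Sending
  \<open>f\<^sup>k(u)\<close> to \<open>f\<^sup>k(v)\<close> is therefore a well-defined isomorphism between any two components
  (\<open>orbit_digraph_iso\<close>).
\<close>

section \<open>Iterating a fractional linear map\<close>

text \<open>
  The \<open>n\<close>-th iterate of \<open>x \<mapsto> (ax + b)/(cx + d)\<close> is given by \<open>M\<^sup>n = sM + tI\<close>, where \<open>M\<close> is the
  coefficient matrix. The scalars \<open>s\<close> and \<open>t\<close> serve all starting points at once; this uniformity
  is what allows orbits to be compared. The common denominator is nonzero because it is the product
  of the factors \<open>c x\<^sub>k + d\<close> met along the orbit.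
\<close>

lemma iterate_fractional_linear:
  fixes a b c d :: "'a :: field"
  shows "\<exists>s t. \<forall>x. (\<forall>k<n. c * x k + d \<noteq> 0 \<and> (c * x k + d) * x (Suc k) = a * x k + b) \<longrightarrow>
    s * (c * x 0 + d) + t \<noteq> 0 \<and> (s * (c * x 0 + d) + t) * x n = s * (a * x 0 + b) + t * x 0"
proof (induction n)
  case 0
  show ?case by (intro exI[of _ 0] exI[of _ 1]) auto
next
  case (Suc n)
  then obtain s t where st: "\<And>x. (\<forall>k<n. c * x k + d \<noteq> 0 \<and> (c * x k + d) * x (Suc k) = a * x k + b) \<Longrightarrow>
    s * (c * x 0 + d) + t \<noteq> 0 \<and> (s * (c * x 0 + d) + t) * x n = s * (a * x 0 + b) + t * x 0"
    by blast
  \<comment> \<open>from \<open>M (sM + tI) = sM\<^sup>2 + tM\<close> and \<open>M\<^sup>2 = (a + d)M - (ad - bc)I\<close>\<close>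
  define s' where "s' = s * (a + d) + t"
  define t' where "t' = - s * (a * d - b * c)"
  have "s' * (c * x 0 + d) + t' \<noteq> 0 \<and>
      (s' * (c * x 0 + d) + t') * x (Suc n) = s' * (a * x 0 + b) + t' * x 0"
    if x: "\<forall>k<Suc n. c * x k + d \<noteq> 0 \<and> (c * x k + d) * x (Suc k) = a * x k + b" for x
  proof -
    define e where "e = s * (c * x 0 + d) + t"
    have e: "e \<noteq> 0" "e * x n = s * (a * x 0 + b) + t * x 0"
      using st[of x] x by (auto simp: e_def)
    have step: "c * x n + d \<noteq> 0" "(c * x n + d) * x (Suc n) = a * x n + b"
      using x by auto
    have den: "s' * (c * x 0 + d) + t' = (c * x n + d) * e"
    proof -
      have "(c * x n + d) * e = c * (e * x n) + d * e"
        by (simp add: algebra_simps)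
      then show ?thesis
        unfolding e(2) by (simp add: e_def s'_def t'_def algebra_simps)
    qed
    have "(c * x n + d) * e * x (Suc n) = e * ((c * x n + d) * x (Suc n))"
      by (simp only: ac_simps)
    also have "\<dots> = a * (e * x n) + b * e"
      unfolding step(2) by (simp add: algebra_simps)
    also have "\<dots> = s' * (a * x 0 + b) + t' * x 0"
      unfolding e(2) by (simp add: e_def s'_def t'_def algebra_simps)
    finally show ?thesis
      using den e(1) step(1) by simp
  qed
  then show ?case by blast
qed

text \<open>
  With \<open>s\<close> as in the preceding lemma, a starting point \<open>z\<close> returns after \<open>n\<close> steps iff \<open>s\<close> times
  \<open>(az + b) - (cz + d)z\<close> vanishes. The second factor is nonzero when \<open>z\<close> is not a fixed point, so
  the condition becomes \<open>s = 0\<close>, in which \<open>z\<close> no longer occurs.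
\<close>

lemma fractional_linear_return_times_eq:
  fixes a b c d :: "'a :: field" and x y :: "nat \<Rightarrow> 'a"
  assumes x: "\<And>k. k < n \<Longrightarrow> c * x k + d \<noteq> 0"
      "\<And>k. k < n \<Longrightarrow> (c * x k + d) * x (Suc k) = a * x k + b"
      "(c * x 0 + d) * x 0 \<noteq> a * x 0 + b"
    and y: "\<And>k. k < n \<Longrightarrow> c * y k + d \<noteq> 0"
      "\<And>k. k < n \<Longrightarrow> (c * y k + d) * y (Suc k) = a * y k + b"
      "(c * y 0 + d) * y 0 \<noteq> a * y 0 + b"
  shows "x n = x 0 \<longleftrightarrow> y n = y 0"
proof -
  obtain s t where st: "\<And>z. (\<forall>k<n. c * z k + d \<noteq> 0 \<and> (c * z k + d) * z (Suc k) = a * z k + b) \<Longrightarrow>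
    s * (c * z 0 + d) + t \<noteq> 0 \<and> (s * (c * z 0 + d) + t) * z n = s * (a * z 0 + b) + t * z 0"
    using iterate_fractional_linear[of n c d a b] by blast
  have "z n = z 0 \<longleftrightarrow> s = 0"
    if z: "\<forall>k<n. c * z k + d \<noteq> 0 \<and> (c * z k + d) * z (Suc k) = a * z k + b"
      and not_fixed: "(c * z 0 + d) * z 0 \<noteq> a * z 0 + b" for z
  proof -
    define e where "e = s * (c * z 0 + d) + t"
    have e: "e \<noteq> 0" "e * z n = s * (a * z 0 + b) + t * z 0"
      using st[OF z] by (auto simp: e_def)
    have "z n = z 0 \<longleftrightarrow> e * z n = e * z 0"
      using e(1) by simp
    also have "\<dots> \<longleftrightarrow> s * ((a * z 0 + b) - (c * z 0 + d) * z 0) = 0"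
      unfolding e(2) by (simp add: e_def algebra_simps)
    also have "\<dots> \<longleftrightarrow> s = 0"
      using not_fixed by auto
    finally show ?thesis .
  qed
  from this[of x] this[of y] x y show ?thesis
    by simp
qed

section \<open>Components of the digraph of a bijection\<close>

text \<open>
  A line if \<open>\<phi>\<close> is injective, and a cycle if \<open>\<phi>\<close> enumerates the orbit of a periodic point. The
  third component of an arc is the index that distinguishes parallel arcs; here there are none.
\<close>

definition orbit_digraph :: "(int \<Rightarrow> 'a) \<Rightarrow> ('a, 'a \<times> 'a \<times> nat) pre_digraph" where
  "orbit_digraph \<phi> =
     \<lparr> verts = range \<phi>,
       arcs = range (\<lambda>k. (\<phi> k, \<phi> (k + 1), 0)),
       tail = (\<lambda>(u, v, k). u),
       head = (\<lambda>(u, v, k). v) \<rparr>"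

text \<open>
  The hypothesis says that the correspondence \<open>\<phi> k \<mapsto> \<psi> k\<close> is well defined and injective; it
  commutes with the shift \<open>k \<mapsto> k + 1\<close>, which defines the arcs.
\<close>

lemma orbit_digraph_iso:
  fixes \<phi> :: "int \<Rightarrow> 'a" and \<psi> :: "int \<Rightarrow> 'b"
  assumes eq: "\<And>i j. \<phi> i = \<phi> j \<longleftrightarrow> \<psi> i = \<psi> j"
  shows "digraph_iso (orbit_digraph \<phi>) (orbit_digraph \<psi>)"
proof -
  define h where "h = (\<lambda>x. \<psi> (SOME k. \<phi> k = x))"
  have h: "h (\<phi> k) = \<psi> k" for k
    unfolding h_def using someI[of "\<lambda>i. \<phi> i = \<phi> k" k] eq by blast
  define F where "F = \<lparr> iso_verts = h, iso_arcs = (\<lambda>(u, v, k :: nat). (h u, h v, k)),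
    iso_head = (\<lambda>(u, v, k). v), iso_tail = (\<lambda>(u, v, k). u) \<rparr>"
  have "wf_digraph (orbit_digraph \<phi>)"
    by unfold_locales (auto simp: orbit_digraph_def)
  then have "pre_digraph.digraph_isomorphism (orbit_digraph \<phi>) F"
    by (auto simp: pre_digraph.digraph_isomorphism_def F_def orbit_digraph_def inj_on_def h eq)
  moreover have "orbit_digraph \<psi> = app_iso F (orbit_digraph \<phi>)"
    by (simp add: app_iso_def F_def orbit_digraph_def image_image h)
  ultimately show ?thesis
    unfolding digraph_iso_def by blast
qed

lemma bij_betw_two_sided_orbit:
  assumes f: "bij_betw f V V" and u: "u \<in> V"
  shows "\<exists>\<phi> :: int \<Rightarrow> 'a. \<phi> 0 = u \<and> (\<forall>k. \<phi> k \<in> V) \<and> (\<forall>k. \<phi> (k + 1) = f (\<phi> k))"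
proof -
  define g where "g = inv_into V f"
  define \<phi> where "\<phi> = (\<lambda>k. if 0 \<le> k then (f ^^ nat k) u else (g ^^ nat (- k)) u)"
  have fV: "f x \<in> V" and gV: "g x \<in> V" and fg: "f (g x) = x" if "x \<in> V" for x
    using f that unfolding g_def
    by (auto simp: bij_betw_def inv_into_into f_inv_into_f)
  have fn: "(f ^^ n) u \<in> V" and gn: "(g ^^ n) u \<in> V" for n
    by (induction n) (auto simp: u fV gV)
  have "\<phi> (k + 1) = f (\<phi> k)" for k
  proof (cases "0 \<le> k")
    case True
    then show ?thesis by (simp add: \<phi>_def nat_add_distrib)
  next
    case False
    then have "nat (- k) = Suc (nat (- (k + 1)))" by auto
    then have "f (\<phi> k) = (g ^^ nat (- (k + 1))) u"
      using False by (simp add: \<phi>_def fg gn)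
    then show ?thesis
      using False by (cases "k + 1 = 0") (auto simp: \<phi>_def)
  qed
  moreover have "\<phi> 0 = u" "\<forall>k. \<phi> k \<in> V"
    using fn gn by (auto simp: \<phi>_def)
  ultimately show ?thesis by blast
qed

text \<open>
  In the underlying undirected graph the neighbours of \<open>\<phi> k\<close> are \<open>\<phi> (k + 1)\<close> and \<open>\<phi> (k - 1)\<close>
  only, the latter because \<open>f\<close> is injective. So a path from \<open>u\<close> never leaves the orbit, and the
  orbit is traversed in both directions by such paths.
\<close>

lemma component_of_bijection_digraph:
  assumes f: "bij_betw f V V"
    and H: "H = \<lparr> verts = V, arcs = {(x, f x, 0) | x. x \<in> V},
      tail = (\<lambda>(u, v, k :: nat). u), head = (\<lambda>(u, v, k). v) \<rparr>"
    and \<phi>: "\<phi> 0 = u" "\<And>k. \<phi> k \<in> V" "\<And>k. \<phi> (k + 1) = f (\<phi> k)"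
  shows "component_of H u = orbit_digraph \<phi>"
proof -
  have "wf_digraph H"
    using f by unfold_locales (auto simp: H bij_betw_def)
  then interpret S: pair_wf_digraph "mk_symmetric H"
    by (rule wf_digraph.wellformed_mk_symmetric)
  have parcs: "parcs (mk_symmetric H) = {(x, f x) | x. x \<in> V} \<union> {(f x, x) | x. x \<in> V}"
    by (auto simp: parcs_mk_symmetric H)
  have reach: "u \<rightarrow>\<^sup>*\<^bsub>with_proj (mk_symmetric H)\<^esub> v \<longleftrightarrow> v \<in> range \<phi>" for v
  proof
    assume "u \<rightarrow>\<^sup>*\<^bsub>with_proj (mk_symmetric H)\<^esub> v"
    then show "v \<in> range \<phi>"
    proof (induction rule: S.reachable_induct)
      case base
      then show ?case using \<phi>(1) by blast
    next
      case (step x y)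
      then obtain k where k: "x = \<phi> k" by blast
      have "y = f x \<or> y \<in> V \<and> x = f y"
        using step.hyps parcs by auto
      then show ?case
      proof
        assume "y = f x"
        then show ?thesis using k \<phi>(3) by (metis rangeI)
      next
        assume y: "y \<in> V \<and> x = f y"
        have "f (\<phi> (k - 1)) = x" using \<phi>(3)[of "k - 1"] k by simp
        then have "y = \<phi> (k - 1)"
          using y \<phi>(2) f by (metis bij_betw_imp_inj_on inj_onD)
        then show ?thesis by blast
      qed
    qed
  next
    have "u \<rightarrow>\<^sup>*\<^bsub>with_proj (mk_symmetric H)\<^esub> \<phi> k" for k
    proof (induction k rule: int_induct[where k = 0])
      case base
      have "u \<in> verts (with_proj (mk_symmetric H))"
        using \<phi>(1) \<phi>(2)[of 0] by (simp add: H)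
      then show ?case using \<phi>(1) S.reachable_refl by simp
    next
      case (step1 i)
      have "(\<phi> i, \<phi> (i + 1)) \<in> parcs (mk_symmetric H)"
        using \<phi>(2,3) parcs by auto
      then show ?case using step1(2) S.reachable_adj_trans by simp
    next
      case (step2 i)
      have "\<phi> i = f (\<phi> (i - 1))" using \<phi>(3)[of "i - 1"] by simp
      then have "(\<phi> i, \<phi> (i - 1)) \<in> parcs (mk_symmetric H)"
        using \<phi>(2) parcs by auto
      then show ?case using step2(2) S.reachable_adj_trans by simp
    qed
    then show "v \<in> range \<phi> \<Longrightarrow> u \<rightarrow>\<^sup>*\<^bsub>with_proj (mk_symmetric H)\<^esub> v" by blast
  qed
  have "component_of H u = H \<restriction> range \<phi>"
    unfolding component_of_def reach by simp
  also have "\<dots> = orbit_digraph \<phi>"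
  proof -
    have "f (\<phi> k) \<in> range \<phi>" for k
      by (metis \<phi>(3) rangeI)
    then have "arcs (H \<restriction> range \<phi>) = range (\<lambda>k. (\<phi> k, \<phi> (k + 1), 0))"
      using \<phi>(2,3) by (auto simp: H)
    then show ?thesis
      by (simp add: induce_subgraph_def orbit_digraph_def H)
  qed
  finally show ?thesis .
qed

section \<open>Removing singular components\<close>

lemma wf_poly_digraph: "wf_digraph (poly_digraph \<Phi>)"
  by unfold_locales (auto simp: poly_digraph_def)

lemma verts_poly_digraph_star_nonsingular:
  assumes "w \<in> verts (poly_digraph_star \<Phi>)"
  shows "\<not> singular_vertex \<Phi> w"
proof
  interpret S: pair_wf_digraph "mk_symmetric (poly_digraph \<Phi>)"
    by (rule wf_digraph.wellformed_mk_symmetric[OF wf_poly_digraph])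
  assume "singular_vertex \<Phi> w"
  moreover have "w \<in> verts (component_of (poly_digraph \<Phi>) w)"
    using S.reachable_refl[of w] by (simp add: component_of_def poly_digraph_def)
  ultimately show False
    using assms by (auto simp: poly_digraph_star_def singular_components_def components_def
        poly_digraph_def)
qed

text \<open>
  Removing whole components cuts no arcs: a neighbour of a vertex of a singular component belongs to
  the same component.
\<close>

lemma verts_poly_digraph_star_adjacent:
  assumes w: "w \<in> verts (poly_digraph_star \<Phi>)"
    and adj: "arc_mult \<Phi> w v > 0 \<or> arc_mult \<Phi> v w > 0"
  shows "v \<in> verts (poly_digraph_star \<Phi>)"
proof (rule ccontr)
  let ?G = "poly_digraph \<Phi>"
  interpret S: pair_wf_digraph "mk_symmetric ?G"
    by (rule wf_digraph.wellformed_mk_symmetric[OF wf_poly_digraph])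
  assume "v \<notin> verts (poly_digraph_star \<Phi>)"
  then obtain C where C: "C \<in> singular_components \<Phi>" "v \<in> verts C"
    by (auto simp: poly_digraph_star_def poly_digraph_def)
  then obtain u where u: "C = component_of ?G u"
    by (auto simp: singular_components_def components_def)
  have "u \<rightarrow>\<^sup>*\<^bsub>with_proj (mk_symmetric ?G)\<^esub> v"
    using C(2) u by (simp add: component_of_def)
  moreover have "(v, w) \<in> parcs (mk_symmetric ?G)"
    using adj by (force simp: parcs_mk_symmetric poly_digraph_def)
  ultimately have "u \<rightarrow>\<^sup>*\<^bsub>with_proj (mk_symmetric ?G)\<^esub> w"
    using S.reachable_adj_trans by simp
  then have "w \<in> verts C"
    using u by (simp add: component_of_def)
  then show False
    using w C(1) by (auto simp: poly_digraph_star_def)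
qed

section \<open>The polynomial of a fractional linear map\<close>

lemma swap_vars_bilinear:
  "swap_vars [: - [:b, a:], [:d, c:] :] = [: [:- b, d:], [:- a, c:] :]"
  by (intro poly_eqI) (auto simp: coeff_coeff_swap_vars coeff_pCons split: nat.splits)

lemma degree_normalize_field:
  fixes p :: "'a :: {field, normalization_semidom} poly"
  shows "degree (normalize p) = degree p"
  by (cases "p = 0") (auto intro!: antisym dvd_imp_degree_le)

text \<open>
  If \<open>ad = bc\<close>, then \<open>\<Phi>\<close> splits into a factor in \<open>x\<close> and a factor in \<open>y\<close>, one of which is not
  constant and makes a content nonconstant: for \<open>c \<noteq> 0\<close> the polynomial \<open>cx + d\<close> divides \<open>ax + b\<close>,
  for \<open>c = d = 0\<close> only \<open>-(ax + b)\<close> is left, and for \<open>c = a = 0\<close> only \<open>dy - b\<close>.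
\<close>

lemma standard_bilinear_det_nonzero:
  fixes a b c d :: complex
  assumes std: "standard [: - [:b, a:], [:d, c:] :]"
  shows "a * d \<noteq> b * c"
proof
  let ?\<Phi> = "[: - [:b, a:], [:d, c:] :]"
  assume det: "a * d = b * c"
  have A: "degree (content ?\<Phi>) = 0" and B: "degree (content (swap_vars ?\<Phi>)) = 0"
    and nc: "\<And>k. ?\<Phi> \<noteq> [:[:k:]:]"
    using std by (auto simp: standard_def poly_A_def poly_B_def)
  have nz: "?\<Phi> \<noteq> 0" using nc[of 0] by auto
  show False
  proof (cases "c = 0")
    case False
    have "[:b, a:] = smult (a / c) [:d, c:]"
      using False det by (simp add: field_simps)
    then have "[:d, c:] dvd - [:b, a:]"
      by (metis dvd_minus_iff dvd_refl dvd_smult)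
    then have "[:[:d, c:]:] dvd ?\<Phi>"
      unfolding const_poly_dvd_iff by (auto simp: coeff_pCons split: nat.splits)
    then have "[:d, c:] dvd content ?\<Phi>"
      unfolding const_poly_dvd_iff_dvd_content .
    then have "degree [:d, c:] \<le> degree (content ?\<Phi>)"
      using nz by (intro dvd_imp_degree_le) auto
    then show False using A False by simp
  next
    case c: True
    show False
    proof (cases "d = 0")
      case True
      then have "a = 0"
        using A c by (simp add: degree_normalize_field split: if_splits)
      then show False using nc[of "- b"] c True by auto
    next
      case False
      then have "a = 0" using c det by simp
      then show False using B c False unfolding swap_vars_bilinear by (simp add: degree_normalize_field)
    qed
  qed
qed

text \<open>
  Here \<open>\<Phi>\<close> is linear in each variable, so the derivatives are constant in the variable to be
  eliminated and the resultants \<open>D\<close> and \<open>E\<close> are the leading coefficients \<open>cx + d\<close> and \<open>cy - a\<close>.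
  They are nonzero as polynomials because \<open>ad \<noteq> bc\<close>.
\<close>

lemma singular_vertex_bilinear_iff:
  fixes a b c d :: complex
  assumes det: "a * d \<noteq> b * c"
  shows "singular_vertex [: - [:b, a:], [:d, c:] :] u \<longleftrightarrow>
    (c * u + d) * u = a * u + b \<or> c * u + d = 0 \<or> c * u = a"
proof -
  let ?\<Phi> = "[: - [:b, a:], [:d, c:] :]"
  have nz: "[:d, c:] \<noteq> 0" "[:- a, c:] \<noteq> 0" using det by auto
  have L: "poly (poly_L ?\<Phi>) u = (c * u + d) * u - (a * u + b)"
    by (simp add: poly_L_def algebra_simps)
  have "poly_D ?\<Phi> = [:d, c:]"
    using nz by (simp add: poly_D_def pderiv_pCons)
  moreover have "poly_E ?\<Phi> = [:- a, c:]"
    unfolding poly_E_def swap_vars_bilinear using nz by (simp add: pderiv_pCons)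
  ultimately have "poly (poly_S ?\<Phi>) u =
      ((c * u + d) * u - (a * u + b)) * (c * u + d) * (c * u - a)"
    unfolding poly_S_def poly_mult L by (simp add: algebra_simps)
  then show ?thesis
    unfolding singular_vertex_def by auto
qed

text \<open>
  At the pole, where \<open>cu + d = 0\<close>, invertibility forces \<open>au + b \<noteq> 0\<close>. So the polynomial in \<open>y\<close> is a
  nonzero constant there, with no roots, in accordance with the equation having no solution \<open>v\<close>.
\<close>

lemma arc_mult_bilinear:
  fixes a b c d :: complex
  assumes det: "a * d \<noteq> b * c"
  shows "arc_mult [: - [:b, a:], [:d, c:] :] u v = (if (c * u + d) * v = a * u + b then 1 else 0)"
proof -
  define p where "p = at_x [: - [:b, a:], [:d, c:] :] u"
  have p: "p = [: - (a * u + b), c * u + d :]"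
    by (intro poly_eqI) (auto simp: p_def at_x_def coeff_map_poly coeff_pCons algebra_simps split: nat.splits)
  have "p \<noteq> 0"
  proof
    assume "p = 0"
    then have "a * u + b = 0" "c * u + d = 0" by (auto simp: p)
    moreover have "a * d - b * c = a * (c * u + d) - c * (a * u + b)" by (simp add: algebra_simps)
    ultimately show False using det by simp
  qed
  moreover have "order v p = (if (c * u + d) * v = a * u + b then 1 else 0)"
  proof (cases "(c * u + d) * v = a * u + b")
    case True
    then have "p = smult (c * u + d) [:- v, 1:]" by (simp add: p algebra_simps)
    moreover from this have "c * u + d \<noteq> 0" using \<open>p \<noteq> 0\<close> by auto
    ultimately show ?thesis using True using order_power_n_n[of v 1] by (simp add: order_smult del: smult_pCons)
  next
    case False
    then have "poly p v \<noteq> 0" by (simp add: p algebra_simps)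
    then show ?thesis using False by (simp add: order_0I)
  qed
  ultimately show ?thesis by (simp add: arc_mult_def p_def[symmetric] del: minus_pCons)
qed

text \<open>
  The inverse is \<open>y \<mapsto> (dy - b)/(a - cy)\<close>. Neither map meets its pole, since both poles are singular
  vertices, and both preserve the remaining vertices because they move along arcs.
\<close>

lemma fractional_linear_bij_betw:
  fixes a b c d :: complex
  assumes det: "a * d \<noteq> b * c"
    and \<Phi>: "\<Phi> = [: - [:b, a:], [:d, c:] :]"
  shows "bij_betw (\<lambda>x. (a * x + b) / (c * x + d))
    (verts (poly_digraph_star \<Phi>)) (verts (poly_digraph_star \<Phi>))"
proof -
  define V where "V = verts (poly_digraph_star \<Phi>)"
  have ns: "c * x + d \<noteq> 0" "a - c * x \<noteq> 0" if "x \<in> V" for x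
    using verts_poly_digraph_star_nonsingular that singular_vertex_bilinear_iff[OF det]
    by (auto simp: V_def \<Phi>)
  have adj: "y \<in> V"
    if "x \<in> V" "(c * x + d) * y = a * x + b \<or> (c * y + d) * x = a * y + b" for x y
    using verts_poly_digraph_star_adjacent[of x \<Phi> y] that arc_mult_bilinear[OF det]
    by (auto simp: V_def \<Phi>)
  show ?thesis
    unfolding V_def[symmetric]
  proof (rule bij_betwI[where g = "\<lambda>y. (d * y - b) / (a - c * y)"])
    show "(\<lambda>x. (a * x + b) / (c * x + d)) \<in> V \<rightarrow> V"
      using ns adj by auto
    show "(\<lambda>y. (d * y - b) / (a - c * y)) \<in> V \<rightarrow> V"
    proof
      fix y assume y: "y \<in> V"
      show "(d * y - b) / (a - c * y) \<in> V"
        by (rule adj[OF y], rule disjI2) (use ns(2)[OF y] in \<open>simp add: field_simps\<close>)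
    qed
    fix x assume x: "x \<in> V"
    show "(d * ((a * x + b) / (c * x + d)) - b) / (a - c * ((a * x + b) / (c * x + d))) = x"
    proof -
      have "d * ((a * x + b) / (c * x + d)) - b = (a * d - b * c) * x / (c * x + d)"
        "a - c * ((a * x + b) / (c * x + d)) = (a * d - b * c) / (c * x + d)"
        using ns(1)[OF x] by (simp_all add: field_simps)
      then show ?thesis using ns(1)[OF x] det by simp
    qed
    show "(a * ((d * x - b) / (a - c * x)) + b) / (c * ((d * x - b) / (a - c * x)) + d) = x"
    proof -
      have "a * ((d * x - b) / (a - c * x)) + b = (a * d - b * c) * x / (a - c * x)"
        "c * ((d * x - b) / (a - c * x)) + d = (a * d - b * c) / (a - c * x)"
        using ns(2)[OF x] by (simp_all add: field_simps)
      then show ?thesis using ns(2)[OF x] det by simp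
    qed
  qed
qed

lemma poly_digraph_star_bilinear:
  fixes a b c d :: complex
  assumes det: "a * d \<noteq> b * c"
    and \<Phi>: "\<Phi> = [: - [:b, a:], [:d, c:] :]"
    and V: "V = verts (poly_digraph_star \<Phi>)"
    and f: "f = (\<lambda>x. (a * x + b) / (c * x + d))"
  shows "poly_digraph_star \<Phi> = \<lparr> verts = V, arcs = {(x, f x, 0) | x. x \<in> V},
    tail = (\<lambda>(u, v, k :: nat). u), head = (\<lambda>(u, v, k). v) \<rparr>"
proof -
  have ns: "c * x + d \<noteq> 0" if "x \<in> V" for x
    using verts_poly_digraph_star_nonsingular that singular_vertex_bilinear_iff[OF det]
    by (auto simp: V \<Phi>)
  have fV: "f x \<in> V" if "x \<in> V" for x
    using fractional_linear_bij_betw[OF det \<Phi>] that by (auto simp: V f bij_betw_def)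
  have "arcs (poly_digraph_star \<Phi>) = {(x, y, k). x \<in> V \<and> y \<in> V \<and> k < arc_mult \<Phi> x y}"
    by (auto simp: poly_digraph_star_def poly_digraph_def V)
  also have "\<dots> = {(x, f x, 0) | x. x \<in> V}"
  proof -
    have "k < arc_mult \<Phi> x y \<longleftrightarrow> y = f x \<and> k = 0" if "x \<in> V" for x y k
      unfolding \<Phi> arc_mult_bilinear[OF det] f
      using ns[OF that] by (auto simp: nonzero_eq_divide_eq mult.commute)
    then show ?thesis using fV by auto
  qed
  finally have "arcs (poly_digraph_star \<Phi>) = {(x, f x, 0) | x. x \<in> V}" .
  moreover have "tail (poly_digraph_star \<Phi>) = (\<lambda>(u, v, k). u)"
    "head (poly_digraph_star \<Phi>) = (\<lambda>(u, v, k). v)"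
    by (auto simp: poly_digraph_star_def poly_digraph_def)
  ultimately show ?thesis
    using V by (intro pre_digraph.equality) auto
qed

theorem theorem9:
  fixes a b c d :: complex and \<Phi> :: bipoly
  assumes "\<Phi> = [: - [:b, a:], [:d, c:] :]"
    and "standard \<Phi>"
    and "C1 \<in> components (poly_digraph_star \<Phi>)"
    and "C2 \<in> components (poly_digraph_star \<Phi>)"
  shows "digraph_iso C1 C2"
proof -
  have det: "a * d \<noteq> b * c"
    using assms(1,2) standard_bilinear_det_nonzero by blast
  define V where "V = verts (poly_digraph_star \<Phi>)"
  define f where "f = (\<lambda>x. (a * x + b) / (c * x + d))"
  have bij: "bij_betw f V V"
    unfolding f_def V_def by (rule fractional_linear_bij_betw[OF det assms(1)])
  have ns: "c * x + d \<noteq> 0" "(c * x + d) * x \<noteq> a * x + b" if "x \<in> V" for x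
    using verts_poly_digraph_star_nonsingular that singular_vertex_bilinear_iff[OF det]
    by (auto simp: V_def assms(1))
  have comp: "\<exists>\<phi>. C = orbit_digraph \<phi> \<and> (\<forall>k. \<phi> k \<in> V) \<and> (\<forall>k. \<phi> (k + 1) = f (\<phi> k))"
    if C: "C \<in> components (poly_digraph_star \<Phi>)" for C
  proof -
    obtain u where u: "u \<in> V" "C = component_of (poly_digraph_star \<Phi>) u"
      using C by (auto simp: components_def V_def)
    obtain \<phi> :: "int \<Rightarrow> complex" where \<phi>: "\<phi> 0 = u" "\<forall>k. \<phi> k \<in> V" "\<forall>k. \<phi> (k + 1) = f (\<phi> k)"
      using bij_betw_two_sided_orbit[OF bij u(1)] by blast
    have "C = orbit_digraph \<phi>"
      unfolding u(2)
      by (rule component_of_bijection_digraph[OF bij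
            poly_digraph_star_bilinear[OF det assms(1) V_def f_def] \<phi>(1) \<phi>(2,3)[rule_format]])
    then show ?thesis
      using \<phi>(2,3) by blast
  qed
  obtain \<phi> where \<phi>: "C1 = orbit_digraph \<phi>" "\<forall>k. \<phi> k \<in> V" "\<forall>k. \<phi> (k + 1) = f (\<phi> k)"
    using comp[OF assms(3)] by blast
  obtain \<psi> where \<psi>: "C2 = orbit_digraph \<psi>" "\<forall>k. \<psi> k \<in> V" "\<forall>k. \<psi> (k + 1) = f (\<psi> k)"
    using comp[OF assms(4)] by blast
  \<comment> \<open>equality of the \<open>i\<close>-th and \<open>j\<close>-th points of an orbit is a return to the \<open>i\<close>-th point after
    \<open>j - i\<close> steps\<close>
  have le: "\<phi> i = \<phi> j \<longleftrightarrow> \<psi> i = \<psi> j" if "i \<le> j" for i j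
  proof -
    define n where "n = nat (j - i)"
    have j: "j = i + int n"
      using that by (simp add: n_def)
    have orbit: "c * \<chi> (i + int k) + d \<noteq> 0"
      "(c * \<chi> (i + int k) + d) * \<chi> (i + int (Suc k)) = a * \<chi> (i + int k) + b"
      "(c * \<chi> (i + int 0) + d) * \<chi> (i + int 0) \<noteq> a * \<chi> (i + int 0) + b"
      if \<chi>: "\<forall>k. \<chi> k \<in> V" "\<forall>k. \<chi> (k + 1) = f (\<chi> k)" for \<chi> :: "int \<Rightarrow> complex" and k
    proof -
      have \<chi>V: "\<chi> l \<in> V" for l using \<chi>(1) by blast
      have succ: "\<chi> (i + int (Suc k)) = f (\<chi> (i + int k))"
        using \<chi>(2)[rule_format, of "i + int k"] by (simp add: ac_simps)
      show "c * \<chi> (i + int k) + d \<noteq> 0"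
        by (rule ns(1)[OF \<chi>V])
      then show "(c * \<chi> (i + int k) + d) * \<chi> (i + int (Suc k)) = a * \<chi> (i + int k) + b"
        unfolding succ by (simp add: f_def)
      show "(c * \<chi> (i + int 0) + d) * \<chi> (i + int 0) \<noteq> a * \<chi> (i + int 0) + b"
        by (rule ns(2)[OF \<chi>V])
    qed
    have "\<phi> (i + int n) = \<phi> (i + int 0) \<longleftrightarrow> \<psi> (i + int n) = \<psi> (i + int 0)"
      by (rule fractional_linear_return_times_eq[where a = a and b = b and c = c and d = d])
        (rule orbit[OF \<phi>(2,3)] orbit[OF \<psi>(2,3)])+
    then show ?thesis
      using j by (simp add: eq_commute)
  qed
  have "\<phi> i = \<phi> j \<longleftrightarrow> \<psi> i = \<psi> j" for i j
    using le[of i j] le[of j i] by (metis linear)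
  then show ?thesis
    unfolding \<phi>(1) \<psi>(1) by (rule orbit_digraph_iso)
qed

end
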